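(* Let $(p,p_F)$ be a circle pattern in $\mathbf{E}^2$ and let $(p^{\mathcal L},p^{\mathcal L}_F)$ be any Lorentz lift of it. Then $(p^{\mathcal L},p^{\mathcal L}_F)$ is a contact congruence.
   Context: $\mathbb{Z}^2$ is the vertex set of the square lattice graph, $F(\mathbb{Z}^2)$ its set of unit square faces. A circle pattern is a pair of maps $p$ from $\mathbb{Z}^2$ to circles in the Euclidean plane $\mathbf{E}^2$ and $p_F:F(\mathbb{Z}^2)\to\mathbf{E}^2$ with $p_F(f)\in p(v)$ whenever $v,f$ are incident; $\mathring p(v)$ denotes the center of $p(v)$. Nondegeneracy: all radii are positive, $\mathring p(v)\neq\mathring p(v')$ for adjacent $v,v'$, and for each edge $(v,v')$ with adjacent faces $f,f'$ the point $p_F(f')$ is the reflection of $p_F(f)$ in the line through $\mathring p(v)$ and $\mathring p(v')$. For adjacent faces $f,f'$ with common edge $(v,v')$ let $\rho(f,f')$ be this reflection; the composition of these reflections along any closed cycle of adjacent faces is the identity. Lorentz space $\mathbf{L}^3$ is $\mathbb{R}^3$ with $\langle x,y\rangle=x_1y_1+x_2y_2-x_3y_3$, and $\mathbf{E}^2=\{x_3=0\}$. An oriented timelike sphere has center $m$ and signed radius $r\neq0$, with point set $\{x:\langle x-m,x-m\rangle=r^2\}$ (outward oriented if $r>0$, inward if $r<0$); a null-sphere is $\{x:\langle x-m,x-m\rangle=0\}$. An isotropic line is $L=\{q+td\}$, $d\neq0$, $\langle d,d\rangle=0$, contained in the unique isotropic plane $H_L=\{x:\langle x-q,d\rangle=0\}$;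 an orientation of $L$ is a choice of a component $\Omega$ of $H_L\setminus L$. A null-sphere is in contact with $(L,\Omega)$ iff its center lies on $L$; an oriented timelike sphere $(m,r)$ is in contact with $(L,\Omega)$ iff it contains $L$ (forcing $m\in H_L\setminus L$) and $m\notin\Omega$ if $r>0$, $m\in\Omega$ if $r<0$. A contact congruence is a pair of maps $c$ (from $\mathbb{Z}^2$ to oriented timelike spheres and null-spheres) and $c_F$ (from $F(\mathbb{Z}^2)$ to oriented isotropic lines) such that $c(v)$ is in oriented contact with $c_F(f)$ whenever $v,f$ are incident. Lorentz lift of a circle pattern $(p,p_F)$: choose a face $f_0$ and an oriented isotropic line $p^{\mathcal L}_F(f_0)$ through the point $p_F(f_0)$. For adjacent faces let $\rho^{\mathcal L}(f,f')$ be the reflection of $\mathbf{L}^3$ in the vertical plane above the fixed line of $\rho(f,f')$, i.e. it acts as $\rho(f,f')$ on $(x_1,x_2)$ and fixes $x_3$. Define $p^{\mathcal L}_F$ on all faces by $p^{\mathcal L}_F(f)=\rho^{\mathcal L}(f,f')(p^{\mathcal L}_F(f'))$ for adjacent $f,f'$ (acting on lines together with their chosen components); this is well defined since the reflections compose to the identity along closed cycles. For $v\in\mathbb{Z}^2$, choose one face $f$ incident to $v$; $p^{\mathcal L}(v)$ is the oriented timelike sphere or null-sphere swept out by rotating the line $p^{\mathcal L}_F(f)$ about the vertical line through $\mathring p(v)$, oriented such that it is in oriented contact with $p^{\mathcal L}_F(f)$. *)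

theory Defs
  imports "HOL-Analysis.Analysis"
begin

section \<open>The square lattice\<close>

type_synonym vertex = "int \<times> int"

text \<open>A face of the lattice is named by its lower left corner.\<close>
datatype face = Face int int

fun corners :: "face \<Rightarrow> vertex set" where
  "corners (Face i j) = {(i, j), (i + 1, j), (i, j + 1), (i + 1, j + 1)}"

definition incident :: "vertex \<Rightarrow> face \<Rightarrow> bool" where
  "incident v f \<longleftrightarrow> v \<in> corners f"

definition adjacent :: "vertex \<Rightarrow> vertex \<Rightarrow> bool" where
  "adjacent v w \<longleftrightarrow> \<bar>fst v - fst w\<bar> + \<bar>snd v - snd w\<bar> = 1"

text \<open>The distinct faces \<open>f\<close>, \<open>f'\<close> are adjacent, with common edge \<open>(v, v')\<close>.\<close>
definition common_edge :: "face \<Rightarrow> face \<Rightarrow> vertex \<Rightarrow> vertex \<Rightarrow> bool" where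
  "common_edge f f' v v' \<longleftrightarrow>
     f \<noteq> f' \<and> adjacent v v' \<and> {v, v'} \<subseteq> corners f \<inter> corners f'"


section \<open>Circle patterns\<close>

datatype circle = Circle (ccenter: "real^2") (cradius: real)

definition circle_points :: "circle \<Rightarrow> (real^2) set" where
  "circle_points C = sphere (ccenter C) (cradius C)"

text \<open>
  Reflection of the plane in the line through the distinct points \<open>a\<close> and \<open>b\<close>: the point \<open>x\<close>
  and its image have the foot of the perpendicular from \<open>x\<close> as midpoint.
\<close>
definition line_reflection :: "real^2 \<Rightarrow> real^2 \<Rightarrow> real^2 \<Rightarrow> real^2" where
  "line_reflection a b x =
     2 *\<^sub>R (a + (((x - a) \<bullet> (b - a)) / ((b - a) \<bullet> (b - a))) *\<^sub>R (b - a)) - x"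

text \<open>
  That the reflections compose to the identity along closed cycles of adjacent faces is a
  consequence of these conditions, so it is not one of them.
\<close>
definition circle_pattern :: "(vertex \<Rightarrow> circle) \<Rightarrow> (face \<Rightarrow> real^2) \<Rightarrow> bool" where
  "circle_pattern p pF \<longleftrightarrow>
     (\<forall>v f. incident v f \<longrightarrow> pF f \<in> circle_points (p v)) \<and>
     (\<forall>v. cradius (p v) > 0) \<and>
     (\<forall>v v'. adjacent v v' \<longrightarrow> ccenter (p v) \<noteq> ccenter (p v')) \<and>
     (\<forall>f f' v v'. common_edge f f' v v' \<longrightarrow>
        pF f' = line_reflection (ccenter (p v)) (ccenter (p v')) (pF f))"


section \<open>Lorentz space\<close>

definition lorentz :: "real^3 \<Rightarrow> real^3 \<Rightarrow> real" where
  "lorentz x y = x$1 * y$1 + x$2 * y$2 - x$3 * y$3"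

text \<open>The point of Lorentz space at height \<open>h\<close> above the point \<open>x\<close> of the Euclidean plane.\<close>
definition at_height :: "real \<Rightarrow> real^2 \<Rightarrow> real^3" where
  "at_height h x = vector [x$1, x$2, h]"

definition plane_proj :: "real^3 \<Rightarrow> real^2" where
  "plane_proj x = vector [x$1, x$2]"

text \<open>
  Signed radius \<open>r \<noteq> 0\<close>: oriented timelike sphere (outward if \<open>r > 0\<close>, inward if \<open>r < 0\<close>).
  Radius \<open>0\<close>: null-sphere, which carries no orientation.
\<close>
datatype lsphere = LSphere (lcenter: "real^3") (lradius: real)

definition lsphere_points :: "lsphere \<Rightarrow> (real^3) set" where
  "lsphere_points S = {x. lorentz (x - lcenter S) (x - lcenter S) = (lradius S)\<^sup>2}"

text \<open>An oriented line is a pair of a line and the chosen component of its complement in the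
  isotropic plane containing it.\<close>
type_synonym oline = "(real^3) set \<times> (real^3) set"

definition oriented_isotropic_line :: "oline \<Rightarrow> bool" where
  "oriented_isotropic_line l \<longleftrightarrow>
     (\<exists>q d. d \<noteq> 0 \<and> lorentz d d = 0 \<and>
        fst l = {q + t *\<^sub>R d | t. True} \<and>
        snd l \<in> components ({x. lorentz (x - q) d = 0} - fst l))"

fun oriented_contact :: "lsphere \<Rightarrow> oline \<Rightarrow> bool" where
  "oriented_contact S (L, \<Omega>) \<longleftrightarrow>
     (if lradius S = 0 then lcenter S \<in> L
      else L \<subseteq> lsphere_points S \<and>
           (lradius S > 0 \<longrightarrow> lcenter S \<notin> \<Omega>) \<and> (lradius S < 0 \<longrightarrow> lcenter S \<in> \<Omega>))"

definition contact_congruence :: "(vertex \<Rightarrow> lsphere) \<Rightarrow> (face \<Rightarrow> oline) \<Rightarrow> bool" where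
  "contact_congruence c cF \<longleftrightarrow>
     (\<forall>f. oriented_isotropic_line (cF f)) \<and>
     (\<forall>v f. incident v f \<longrightarrow> oriented_contact (c v) (cF f))"


section \<open>Lorentz lifts\<close>

text \<open>Reflection in the vertical plane above the line through \<open>a\<close> and \<open>b\<close>.\<close>
definition lift_reflection :: "real^2 \<Rightarrow> real^2 \<Rightarrow> real^3 \<Rightarrow> real^3" where
  "lift_reflection a b x = at_height (x$3) (line_reflection a b (plane_proj x))"

text \<open>Rotation by the angle \<open>\<theta>\<close> about the vertical line through \<open>a\<close>.\<close>
definition vertical_rotation :: "real^2 \<Rightarrow> real \<Rightarrow> real^3 \<Rightarrow> real^3" where
  "vertical_rotation a \<theta> x =
     vector [a$1 + cos \<theta> * (x$1 - a$1) - sin \<theta> * (x$2 - a$2),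
             a$2 + sin \<theta> * (x$1 - a$1) + cos \<theta> * (x$2 - a$2),
             x$3]"

text \<open>
  \<open>(pL, pLF)\<close> is a Lorentz lift of \<open>(p, pF)\<close>, for some choice of initial face \<open>f\<^sub>0\<close>, of an oriented
  isotropic line at \<open>f\<^sub>0\<close> and, for every vertex, of an incident face.
\<close>
definition lorentz_lift ::
  "(vertex \<Rightarrow> circle) \<Rightarrow> (face \<Rightarrow> real^2) \<Rightarrow> (vertex \<Rightarrow> lsphere) \<Rightarrow> (face \<Rightarrow> oline) \<Rightarrow> bool" where
  "lorentz_lift p pF pL pLF \<longleftrightarrow>
     (\<exists>f\<^sub>0. oriented_isotropic_line (pLF f\<^sub>0) \<and> at_height 0 (pF f\<^sub>0) \<in> fst (pLF f\<^sub>0)) \<and>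
     (\<forall>f f' v v'. common_edge f f' v v' \<longrightarrow>
        pLF f = map_prod
          (image (lift_reflection (ccenter (p v)) (ccenter (p v'))))
          (image (lift_reflection (ccenter (p v)) (ccenter (p v')))) (pLF f')) \<and>
     (\<forall>v. \<exists>f. incident v f \<and>
        lsphere_points (pL v) = (\<Union>\<theta>. vertical_rotation (ccenter (p v)) \<theta> ` fst (pLF f)) \<and>
        oriented_contact (pL v) (pLF f))"

end

(* The lifted reflections in the edges at v all fix the vertical axis above the centre of p(v)
   pointwise. A lifted sphere has its centre on this axis, because it is invariant under the half
   turn about it; hence the sphere, its centre included, is preserved by the reflections relating
   the four lines around v, and contact with one of these lines yields contact with all. Isotropy
   is transported from f0 to all faces because the lifted reflections are affine Lorentz
   isometries. *)
theory Submission
  imports Defs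
begin

section \<open>Lifted reflections as Lorentz isometries\<close>

text \<open>The linear part of \<open>line_reflection a b\<close> for \<open>n = b - a\<close>.
  Since division by zero gives 0, the case \<open>n = 0\<close> is the map sending z to -z, again a
  linear isometric involution.\<close>

definition axis_reflection :: "'a::real_inner \<Rightarrow> 'a \<Rightarrow> 'a" where
  "axis_reflection n z = (2 * ((z \<bullet> n) / (n \<bullet> n))) *\<^sub>R n - z"

lemma linear_axis_reflection: "linear (axis_reflection n)"
  unfolding axis_reflection_def
  by (rule linearI)
    (simp_all only: inner_add_left inner_scaleR_left add_divide_distrib times_divide_eq_right[symmetric]
      distrib_left scaleR_add_left scaleR_diff_right scaleR_scaleR mult.left_commute add_diff_add)

lemma axis_reflection_inner: "axis_reflection n x \<bullet> axis_reflection n y = x \<bullet> y"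
proof -
  define k l where "k = (x \<bullet> n) / (n \<bullet> n)" and "l = (y \<bullet> n) / (n \<bullet> n)"
  \<comment> \<open>Clearing the denominators makes the expansion below polynomial; for
    \<open>n = 0\<close> both sides vanish.\<close>
  have k: "x \<bullet> n = k * (n \<bullet> n)" and l: "n \<bullet> y = l * (n \<bullet> n)"
    by (cases "n = 0"; simp add: k_def l_def inner_commute)+
  have "axis_reflection n x \<bullet> axis_reflection n y = ((2 * k) *\<^sub>R n - x) \<bullet> ((2 * l) *\<^sub>R n - y)"
    by (simp only: axis_reflection_def k_def l_def)
  also have "\<dots> = 4 * k * l * (n \<bullet> n) - 2 * k * (n \<bullet> y) - 2 * l * (x \<bullet> n) + x \<bullet> y"
    by (simp add: inner_diff_left inner_diff_right right_diff_distrib)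
  also have "\<dots> = x \<bullet> y"
    unfolding k l by simp
  finally show ?thesis .
qed

lemma axis_reflection_involutive [simp]: "axis_reflection n (axis_reflection n x) = x"
proof -
  \<comment> \<open>The component along \<open>n\<close> is kept, so both applications subtract from
    the same vector.\<close>
  have "axis_reflection n x \<bullet> n = x \<bullet> n"
    by (cases "n = 0") (simp_all add: axis_reflection_def inner_diff_left)
  then have "axis_reflection n (axis_reflection n x) = (2 * ((x \<bullet> n) / (n \<bullet> n))) *\<^sub>R n - axis_reflection n x"
    by (simp only: axis_reflection_def[of n "axis_reflection n x"])
  then show ?thesis
    by (simp add: axis_reflection_def)
qed

lemma line_reflection_axis_reflection:
  "line_reflection a b x = a + axis_reflection (b - a) (x - a)"
  by (simp add: line_reflection_def axis_reflection_def scaleR_add_right scaleR_2)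

lemma line_reflection_fixes [simp]: "line_reflection a b a = a"
  by (simp add: line_reflection_def scaleR_2)

lemma line_reflection_involutive [simp]: "line_reflection a b (line_reflection a b x) = x"
  by (simp add: line_reflection_axis_reflection)

lemma line_reflection_diff:
  "line_reflection a b x - line_reflection a b y = axis_reflection (b - a) (x - y)"
  using linear_diff[OF linear_axis_reflection, of "b - a" "x - a" "y - a"]
  by (simp add: line_reflection_axis_reflection)

lemma line_reflection_inner:
  "(line_reflection a b x - line_reflection a b y) \<bullet> (line_reflection a b z - line_reflection a b w)
     = (x - y) \<bullet> (z - w)"
  unfolding line_reflection_diff by (rule axis_reflection_inner)

text \<open>The direction of the image line is a difference of image points, so the same formula
  carries over to \<open>lift_reflection\<close> without naming its linear part.\<close>

lemma line_reflection_affine: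
  "line_reflection a b (x + t *\<^sub>R y) =
     line_reflection a b x + t *\<^sub>R (line_reflection a b (x + y) - line_reflection a b x)"
proof -
  have "line_reflection a b (x + t *\<^sub>R y) - line_reflection a b x
      = t *\<^sub>R (line_reflection a b (x + y) - line_reflection a b x)"
    unfolding line_reflection_diff by (simp add: linear_scale[OF linear_axis_reflection])
  then show ?thesis
    by (simp only: diff_eq_eq add.commute)
qed

lemma at_height_nth [simp]:
  "at_height h x $ 1 = x $ 1" "at_height h x $ 2 = x $ 2" "at_height h x $ 3 = h"
  by (simp_all add: at_height_def)

lemma plane_proj_nth [simp]: "plane_proj x $ 1 = x $ 1" "plane_proj x $ 2 = x $ 2"
  by (simp_all add: plane_proj_def)

lemma plane_proj_at_height [simp]: "plane_proj (at_height h x) = x"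
  by (simp add: vec_eq_iff forall_2)

lemma at_height_plane_proj [simp]: "at_height (x $ 3) (plane_proj x) = x"
  by (simp add: vec_eq_iff forall_3)

lemma plane_proj_height_eqI: "plane_proj x = plane_proj y \<Longrightarrow> x $ 3 = y $ 3 \<Longrightarrow> x = y"
  by (metis at_height_plane_proj)

lemma plane_proj_linear:
  "plane_proj (x + y) = plane_proj x + plane_proj y"
  "plane_proj (x - y) = plane_proj x - plane_proj y"
  "plane_proj (t *\<^sub>R x) = t *\<^sub>R plane_proj x"
  by (simp_all add: vec_eq_iff forall_2)

lemma lorentz_plane_proj: "lorentz x y = plane_proj x \<bullet> plane_proj y - x $ 3 * y $ 3"
  by (simp add: lorentz_def inner_vec_def sum_2)

lemma lift_reflection_nth3 [simp]: "lift_reflection a b x $ 3 = x $ 3"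
  by (simp add: lift_reflection_def)

lemma plane_proj_lift_reflection [simp]:
  "plane_proj (lift_reflection a b x) = line_reflection a b (plane_proj x)"
  by (simp add: lift_reflection_def)

lemma lift_reflection_involutive [simp]: "lift_reflection a b (lift_reflection a b x) = x"
  unfolding lift_reflection_def[of a b "lift_reflection a b x"] by simp

lemma lift_reflection_axis:
  assumes "plane_proj m = a"
  shows "lift_reflection a b m = m"
  using assms at_height_plane_proj[of m] by (simp add: lift_reflection_def)

lemma inj_lift_reflection: "inj (lift_reflection a b)"
  by (metis injI lift_reflection_involutive)

text \<open>Height differences are unchanged and the planar part is a Euclidean isometry. Two
  independent differences are allowed because isotropic planes are given by a pairing, not by a
  norm.\<close>

lemma lift_reflection_lorentz:
  "lorentz (lift_reflection a b x - lift_reflection a b y) (lift_reflection a b z - lift_reflection a b w)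
     = lorentz (x - y) (z - w)"
  by (simp add: lorentz_plane_proj plane_proj_linear line_reflection_inner)

lemma lift_reflection_affine:
  "lift_reflection a b (q + t *\<^sub>R d) =
     lift_reflection a b q + t *\<^sub>R (lift_reflection a b (q + d) - lift_reflection a b q)"
  by (rule plane_proj_height_eqI) (simp_all add: plane_proj_linear line_reflection_affine[of a b _ t])

lemma continuous_on_lift_reflection: "continuous_on S (lift_reflection a b)"
proof -
  have "continuous_on S (\<lambda>x. lift_reflection a b x $ i)" for i :: 3
    using exhaust_3[of i]
    by (elim disjE; simp add: lift_reflection_def line_reflection_def inner_vec_def sum_2 divide_inverse)
      (intro continuous_intros)+
  then have "continuous_on S (\<lambda>x. \<chi> i. lift_reflection a b x $ i)"
    by (rule continuous_on_vec_lambda)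
  then show ?thesis by simp
qed

text \<open>An orientation is a topological component, so transporting it needs a homeomorphism; the
  reflection is its own inverse.\<close>

lemma homeomorphism_lift_reflection:
  "homeomorphism S (lift_reflection a b ` S) (lift_reflection a b) (lift_reflection a b)"
  by (rule homeomorphismI) (auto intro: continuous_on_lift_reflection)

section \<open>Transport of oriented isotropic lines\<close>

lemma components_homeomorphism:
  assumes h: "homeomorphism S T f g" and C: "C \<in> components S"
  shows "f ` C \<in> components T"
proof -
  obtain x where x: "x \<in> S" "C = connected_component_set S x"
    using C by (auto simp: components_iff)
  then have "f ` C = connected_component_set T (f x)"
    using connected_component_set_homeomorphism[OF h, of x] by simp
  moreover have "f x \<in> T" using h x by (auto simp: homeomorphism_def)
  ultimately show ?thesis by (auto simp: components_iff)
qed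

lemma oriented_isotropic_line_reflect:
  fixes a b
  defines "R \<equiv> lift_reflection a b"
  assumes "oriented_isotropic_line l"
  shows "oriented_isotropic_line (map_prod (image R) (image R) l)"
proof -
  obtain q d where d: "d \<noteq> 0" "lorentz d d = 0" and L: "fst l = {q + t *\<^sub>R d | t. True}"
    and C: "snd l \<in> components ({x. lorentz (x - q) d = 0} - fst l)"
    using assms(2) by (auto simp: oriented_isotropic_line_def)
  define q' d' where "q' = R q" and "d' = R (q + d) - R q"
  have "d' \<noteq> 0"
    using d(1) injD[OF inj_lift_reflection, of a b "q + d" q] by (auto simp: d'_def R_def)
  moreover have "lorentz d' d' = 0"
    using d(2) by (simp add: d'_def R_def lift_reflection_lorentz)
  moreover have L': "R ` fst l = {q' + t *\<^sub>R d' | t. True}"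
  proof -
    have "R ` fst l = {R (q + t *\<^sub>R d) | t. True}" by (auto simp: L)
    then show ?thesis
      by (simp add: R_def q'_def d'_def lift_reflection_affine[of a b q _ d])
  qed
  moreover have "R ` snd l \<in> components ({x. lorentz (x - q') d' = 0} - R ` fst l)"
  proof -
    have "lorentz (R x - q') d' = lorentz (x - q) d" for x
      using lift_reflection_lorentz[of a b x q "q + d" q] by (simp add: R_def q'_def d'_def)
    \<comment> \<open>A point \<open>x\<close> of the target plane is the image of
      \<open>R x\<close>, which lies in the source plane.\<close>
    then have "R ` {x. lorentz (x - q) d = 0} = {x. lorentz (x - q') d' = 0}"
      using lift_reflection_involutive[of a b] unfolding R_def image_def by (auto, metis)
    \<comment> \<open>Injectivity lets the image commute with removing the line.\<close>
    then have "R ` ({x. lorentz (x - q) d = 0} - fst l) = {x. lorentz (x - q') d' = 0} - R ` fst l"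
      using inj_lift_reflection[of a b] by (simp add: R_def image_set_diff)
    then show ?thesis
      using components_homeomorphism[OF homeomorphism_lift_reflection C, of a b] by (simp add: R_def)
  qed
  ultimately show ?thesis
    unfolding oriented_isotropic_line_def by auto
qed

text \<open>The centre lies on the mirror plane and is fixed. Its membership in the line or in the
  chosen component therefore does not change, which settles the null case and both signs of the
  radius.\<close>

lemma oriented_contact_reflect:
  assumes axis: "plane_proj (lcenter S) = a" and contact: "oriented_contact S l"
  shows "oriented_contact S (map_prod (image (lift_reflection a b)) (image (lift_reflection a b)) l)"
proof -
  let ?R = "lift_reflection a b" and ?m = "lcenter S"
  have m: "?R ?m = ?m"
    using axis by (rule lift_reflection_axis)
  have mem: "?m \<in> ?R ` X \<longleftrightarrow> ?m \<in> X" for X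
    using m inj_image_mem_iff[OF inj_lift_reflection, of a b ?m X] by simp
  have "?R x \<in> lsphere_points S" if "x \<in> lsphere_points S" for x
    using that lift_reflection_lorentz[of a b x ?m x ?m] by (simp add: lsphere_points_def m)
  then have "X \<subseteq> lsphere_points S \<Longrightarrow> ?R ` X \<subseteq> lsphere_points S" for X
    by blast
  with contact show ?thesis
    by (cases l) (auto simp: mem split: if_splits)
qed

section \<open>Centres of rotationally symmetric spheres\<close>

text \<open>Shifting the angle by \<open>pi\<close> only reindexes the union over all angles, so a
  swept surface is invariant under the half turn.\<close>

lemma vertical_rotation_half_turn:
  "vertical_rotation a pi (vertical_rotation a \<theta> x) = vertical_rotation a (\<theta> + pi) x"
  by (simp add: vertical_rotation_def vec_eq_iff forall_3)

text \<open>Apply the half turn to two antipodal points of the horizontal circle through the centre.\<close>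
lemma lcenter_on_axis:
  assumes S: "lsphere_points S = (\<Union>\<theta>. vertical_rotation a \<theta> ` L)"
  shows "plane_proj (lcenter S) = a"
proof -
  define m r where "m = lcenter S" and "r = lradius S"
  have sym: "vertical_rotation a pi x \<in> lsphere_points S" if "x \<in> lsphere_points S" for x
    using that unfolding S by (fastforce simp: vertical_rotation_half_turn)
  \<comment> \<open>The left side is the squared horizontal distance from the centre to the half
    turn of the point at offset \<open>s\<close> in the first coordinate.\<close>
  have eq: "(2 * (a$1 - m$1) - s)\<^sup>2 + (2 * (a$2 - m$2))\<^sup>2 = r\<^sup>2" if "s\<^sup>2 = r\<^sup>2" for s
  proof -
    have "vector [m$1 + s, m$2, m$3] \<in> lsphere_points S"
      using that by (simp add: lsphere_points_def lorentz_def m_def r_def power2_eq_square)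
    from sym[OF this] show ?thesis
      by (simp add: lsphere_points_def lorentz_def vertical_rotation_def flip: m_def r_def)
        (simp add: power2_eq_square algebra_simps)
  qed
  \<comment> \<open>Adding the equations for \<open>r\<close> and \<open>- r\<close> cancels the
    terms linear in \<open>s\<close>. This also covers radius 0, where both points are the
    centre.\<close>
  have "(a$1 - m$1)\<^sup>2 + (a$2 - m$2)\<^sup>2 = 0"
    using eq[of r] eq[of "- r"] by (simp add: power2_eq_square algebra_simps)
  then show ?thesis
    by (simp add: vec_eq_iff forall_2 m_def)
qed

section \<open>Propagation over the lattice\<close>

lemma common_edge_horizontal: "common_edge (Face i j) (Face (i + 1) j) (i + 1, j) (i + 1, j + 1)"
  by (simp add: common_edge_def adjacent_def)

lemma common_edge_vertical: "common_edge (Face i j) (Face i (j + 1)) (i, j + 1) (i + 1, j + 1)"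
  by (simp add: common_edge_def adjacent_def)

lemma common_edge_sym:
  assumes "common_edge f f' v v'"
  shows "common_edge f' f v v'"
  using assms by (auto simp: common_edge_def adjacent_def)

lemma all_faces_induct:
  assumes base: "P f\<^sub>0" and step: "\<And>f f' v v'. common_edge f f' v v' \<Longrightarrow> P f' \<Longrightarrow> P f"
  shows "P f"
proof -
  obtain i\<^sub>0 j\<^sub>0 where f0: "f\<^sub>0 = Face i\<^sub>0 j\<^sub>0" by (cases f\<^sub>0)
  \<comment> \<open>Symmetry of \<open>common_edge\<close> turns the one-way step into equivalences,
    so the integer inductions can run in both directions: first along the row of the initial face,
    then along each column.\<close>
  have h: "P (Face i j) \<longleftrightarrow> P (Face (i + 1) j)" and v: "P (Face i j) \<longleftrightarrow> P (Face i (j + 1))" for i j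
    using step common_edge_horizontal common_edge_vertical common_edge_sym by blast+
  have row: "P (Face i j\<^sub>0)" for i
  proof (induction i rule: int_induct[of _ i\<^sub>0])
    case (step2 i) then show ?case using h[of "i - 1" j\<^sub>0] by simp
  qed (use base f0 h in auto)
  have "P (Face i j)" for i j
  proof (induction j rule: int_induct[of _ j\<^sub>0])
    case (step2 j) then show ?case using v[of i "j - 1"] by simp
  qed (use row v in auto)
  then show ?thesis by (cases f) simp
qed

text \<open>Only edges ending at \<open>v\<close> are crossed, so that every reflection involved
  fixes the vertical axis above the centre belonging to \<open>v\<close>.\<close>

lemma faces_around_vertex_induct:
  assumes inc: "incident v f\<^sub>1" "incident v f" and base: "P f\<^sub>1"
    and step: "\<And>f f' v'. common_edge f f' v v' \<Longrightarrow> P f' \<Longrightarrow> P f"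
  shows "P f"
proof -
  obtain x y where v: "v = (x, y)" by (cases v)
  define A B C D where "A = Face (x - 1) (y - 1)" and "B = Face x (y - 1)"
    and "C = Face (x - 1) y" and "D = Face x y"
  have faces: "g \<in> {A, B, C, D}" if "incident v g" for g
    using that by (cases g) (auto simp: incident_def v A_def B_def C_def D_def)
  \<comment> \<open>\<open>A\<close>, \<open>B\<close> are the lower and \<open>C\<close>,
    \<open>D\<close> the upper faces at \<open>v\<close>; they form a cycle of four adjacent
    faces.\<close>
  have edges: "common_edge A B v (x, y - 1)" "common_edge C D v (x, y + 1)"
    "common_edge A C v (x - 1, y)" "common_edge B D v (x + 1, y)"
    by (auto simp: common_edge_def adjacent_def v A_def B_def C_def D_def)
  have "P A \<longleftrightarrow> P B" "P C \<longleftrightarrow> P D" "P A \<longleftrightarrow> P C" "P B \<longleftrightarrow> P D"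
    using step edges common_edge_sym by blast+
  then show ?thesis
    using faces[OF inc(1)] faces[OF inc(2)] base by auto
qed

theorem theorem4p4:
  fixes p :: "vertex \<Rightarrow> circle" and pF :: "face \<Rightarrow> real^2"
    and pL :: "vertex \<Rightarrow> lsphere" and pLF :: "face \<Rightarrow> oline"
  assumes "circle_pattern p pF"
    and "lorentz_lift p pF pL pLF"
  shows "contact_congruence pL pLF"
proof -
  let ?R = "\<lambda>v v'. lift_reflection (ccenter (p v)) (ccenter (p v'))"
  obtain f\<^sub>0 where f0: "oriented_isotropic_line (pLF f\<^sub>0)"
    using assms(2) by (auto simp: lorentz_lift_def)
  have refl: "pLF f = map_prod (image (?R v v')) (image (?R v v')) (pLF f')"
    if "common_edge f f' v v'" for f f' v v'
    using assms(2) that unfolding lorentz_lift_def by blast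
  have "oriented_isotropic_line (pLF f)" for f
  proof (rule all_faces_induct[of "\<lambda>f. oriented_isotropic_line (pLF f)", OF f0])
    fix f f' v v'
    assume "common_edge f f' v v'" "oriented_isotropic_line (pLF f')"
    then show "oriented_isotropic_line (pLF f)"
      using oriented_isotropic_line_reflect by (simp add: refl[of f f' v v'])
  qed
  moreover have "oriented_contact (pL v) (pLF f)" if "incident v f" for v f
  proof -
    obtain f\<^sub>1 where f1: "incident v f\<^sub>1" "oriented_contact (pL v) (pLF f\<^sub>1)"
      and sweep: "lsphere_points (pL v) =
        (\<Union>\<theta>. vertical_rotation (ccenter (p v)) \<theta> ` fst (pLF f\<^sub>1))"
      using assms(2) unfolding lorentz_lift_def by blast
    \<comment> \<open>This puts the centre on the mirror planes of all \<open>?R v v'\<close> at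
      once.\<close>
    have axis: "plane_proj (lcenter (pL v)) = ccenter (p v)"
      using sweep by (rule lcenter_on_axis)
    show ?thesis
    proof (rule faces_around_vertex_induct[of v f\<^sub>1 f "\<lambda>f. oriented_contact (pL v) (pLF f)"])
      fix f f' v'
      assume "common_edge f f' v v'" "oriented_contact (pL v) (pLF f')"
      then show "oriented_contact (pL v) (pLF f)"
        using oriented_contact_reflect[OF axis] by (simp add: refl[of f f' v v'])
    qed (use f1 that in auto)
  qed
  ultimately show ?thesis
    by (simp add: contact_congruence_def)
qed

end
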